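(* Let $H=(V,E)$ be a hypergraph with $|V|=n$, every edge having at least two vertices, with minimum edge size $k_{\min}$ and maximum edge size $k_{\max}$. Let $\lambda_2$ and $\lambda_n$ be the second smallest and the largest eigenvalues of the Laplacian $L$ of $H$. For a nonempty proper subset $S\subset V$ define the edge density $\rho(S)=\frac{|\partial S|}{|S|(n-|S|)}$. Then $$ \frac{4 \lambda_2}{n\,k^2_{\max}} \leq \rho(S) \leq \frac{\lambda_n }{n(k_{\min}-1)} .$$
   Context: For $V=\{1,\dots,n\}$, the adjacency matrix $A=(a_{ij})$ has $a_{ii}=0$ and, for $i\ne j$, $a_{ij}$ equal to the number of edges containing both $i$ and $j$. The Laplacian degree is $\delta_i=\sum_j a_{ij}$ and the Laplacian is $L=\mathrm{diag}(\delta_1,\dots,\delta_n)-A$, with eigenvalues $\lambda_1\le\lambda_2\le\dots\le\lambda_n$. The edge boundary $\partial S$ is the set of edges $e\in E$ that intersect both $S$ and $V\setminus S$. *)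

theory Defs
  imports
    Complex_Main
    "HOL-Computational_Algebra.Polynomial"
    "HOL-Library.Multiset"
    "Jordan_Normal_Form.Char_Poly"
begin

definition hypergraph :: "'v set \<Rightarrow> 'v set set \<Rightarrow> bool" where
  "hypergraph V E \<longleftrightarrow> finite V \<and> (\<forall>e\<in>E. e \<subseteq> V)"

definition min_edge_size :: "'v set set \<Rightarrow> nat" where
  "min_edge_size E = Min (card ` E)"

definition max_edge_size :: "'v set set \<Rightarrow> nat" where
  "max_edge_size E = Max (card ` E)"

definition adj :: "'v set set \<Rightarrow> 'v \<Rightarrow> 'v \<Rightarrow> nat" where
  "adj E i j = (if i = j then 0 else card {e \<in> E. i \<in> e \<and> j \<in> e})"

definition laplacian_degree :: "'v set \<Rightarrow> 'v set set \<Rightarrow> 'v \<Rightarrow> nat" where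
  "laplacian_degree V E i = (\<Sum>j\<in>V. adj E i j)"

text \<open>
  The vertices are \<open>1, \<dots>, n\<close> whereas matrix indices start at \<open>0\<close>:
  row and column \<open>i\<close> of the matrices below belong to the vertex \<open>Suc i\<close>.
\<close>

definition adjacency_matrix :: "nat \<Rightarrow> nat set set \<Rightarrow> real mat" where
  "adjacency_matrix n E = mat n n (\<lambda>(i, j). real (adj E (Suc i) (Suc j)))"

definition laplacian :: "nat \<Rightarrow> nat set set \<Rightarrow> real mat" where
  "laplacian n E =
     mat_diag n (\<lambda>i. real (laplacian_degree {1..n} E (Suc i))) - adjacency_matrix n E"

text \<open>
  The eigenvalues of a real matrix with their algebraic multiplicities, in ascending order.
  For a symmetric matrix the list contains all \<open>n\<close> eigenvalues;
  \<open>nth_eigenvalue A k\<close> counts from \<open>k = 1\<close>.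
\<close>

definition eigenvalue_list :: "real mat \<Rightarrow> real list" where
  "eigenvalue_list A = sorted_list_of_multiset (proots (char_poly A))"

definition nth_eigenvalue :: "real mat \<Rightarrow> nat \<Rightarrow> real" where
  "nth_eigenvalue A k = eigenvalue_list A ! (k - 1)"

definition edge_boundary :: "'v set \<Rightarrow> 'v set set \<Rightarrow> 'v set \<Rightarrow> 'v set set" where
  "edge_boundary V E S = {e \<in> E. e \<inter> S \<noteq> {} \<and> e \<inter> (V - S) \<noteq> {}}"

definition edge_density :: "'v set \<Rightarrow> 'v set set \<Rightarrow> 'v set \<Rightarrow> real" where
  "edge_density V E S =
     real (card (edge_boundary V E S)) / (real (card S) * (real (card V) - real (card S)))"

end

theory Submission
  imports Defs "Jordan_Normal_Form.Schur_Decomposition"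
begin

text \<open>
  The quadratic form of the Laplacian is half the sum of \<open>(f i - f j)\<^sup>2\<close> over all edges \<open>e\<close> and
  all \<open>i, j \<in> e\<close>. For the vector equal to \<open>n - |S|\<close> on \<open>S\<close> and \<open>-|S|\<close> off \<open>S\<close>, which is
  orthogonal to the constants, it equals \<open>n\<^sup>2\<close> times the sum of the products
  \<open>|e \<inter> S| |e - S|\<close>. Such a product vanishes off the boundary of \<open>S\<close>, and on the boundary it
  lies between \<open>|e| - 1\<close> and \<open>|e|\<^sup>2 / 4\<close>. The Rayleigh bounds for \<open>\<lambda>\<^sub>2\<close> and \<open>\<lambda>\<^sub>n\<close>, which come
  from an orthogonal diagonalization with the eigenvalues in ascending order, give both inequalities.
\<close>

section \<open>Spectrum of a real symmetric matrix\<close>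

text \<open>For a complex eigenvector \<open>v\<close>, symmetry lets the matrix move from
  \<open>v\<close> to its conjugate in the Hermitian square of \<open>v\<close>, which turns the
  factor \<open>a\<close> into its conjugate; the square is nonzero, so the two agree.\<close>

lemma symmetric_real_eigenvalue:
  fixes A :: "real mat"
  assumes A: "A \<in> carrier_mat n n" and sym: "transpose_mat A = A"
    and ev: "eigenvalue (map_mat complex_of_real A) a"
  shows "a \<in> \<real>"
proof -
  let ?A = "map_mat complex_of_real A"
  have cA: "?A \<in> carrier_mat n n" using A by simp
  have symA: "transpose_mat ?A = ?A" using sym
    by (metis (no_types, lifting) map_mat_transpose)
  from ev obtain v where v: "v \<in> carrier_vec n" "v \<noteq> 0\<^sub>v n" "?A *\<^sub>v v = a \<cdot>\<^sub>v v"
    unfolding eigenvalue_def eigenvector_def using A by auto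
  have cv: "conjugate v \<in> carrier_vec n" using v by simp
  \<comment> \<open>The entries are real, so conjugation commutes with the matrix.\<close>
  have conj: "?A *\<^sub>v conjugate v = conjugate a \<cdot>\<^sub>v conjugate v"
  proof -
    have "?A *\<^sub>v conjugate v = conjugate (?A *\<^sub>v v)"
    proof (rule eq_vecI)
      fix i assume i: "i < dim_vec (conjugate (?A *\<^sub>v v))"
      then show "(?A *\<^sub>v conjugate v) $ i = conjugate (?A *\<^sub>v v) $ i"
        using A v(1) by (auto simp: scalar_prod_def sum_conjugate conjugate_dist_mul intro!: sum.cong)
    qed simp
    also have "\<dots> = conjugate a \<cdot>\<^sub>v conjugate v"
      unfolding v(3) by (rule eq_vecI) (auto simp: conjugate_dist_mul)
    finally show ?thesis .
  qed
  have "a * (v \<bullet>c v) = (?A *\<^sub>v v) \<bullet> conjugate v" using v cv by simp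
  also have "\<dots> = v \<bullet> (?A *\<^sub>v conjugate v)"
    using transpose_vec_mult_scalar[OF cA v(1) cv] cv v cA symA
    by (metis comm_scalar_prod mult_mat_vec_carrier)
  also have "\<dots> = conjugate a * (v \<bullet>c v)" unfolding conj using v cv by simp
  finally have "a = conjugate a" using conjugate_square_eq_0_vec[OF v(1)] v(2) by simp
  then show ?thesis by (simp add: complex_is_Real_iff complex_eq_iff)
qed

text \<open>Over the complex numbers the polynomial splits, with real roots by the preceding lemma.
  Embedding real polynomials into complex ones is injective, so the factorization descends.\<close>

lemma symmetric_char_poly_splits:
  fixes A :: "real mat"
  assumes A: "A \<in> carrier_mat n n" and sym: "transpose_mat A = A"
  shows "\<exists>es. char_poly A = (\<Prod>e\<leftarrow>es. [:- e, 1:])"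
proof -
  interpret p: map_poly_inj_idom_hom complex_of_real ..
  let ?A = "map_mat complex_of_real A"
  have cA: "?A \<in> carrier_mat n n" using A by simp
  obtain as where as: "char_poly ?A = (\<Prod>a\<leftarrow>as. [:- a, 1:])"
    using char_poly_factorized[OF cA] by blast
  have "a \<in> \<real>" if "a \<in> set as" for a
  proof (rule symmetric_real_eigenvalue[OF A sym])
    show "eigenvalue ?A a"
      unfolding eigenvalue_root_char_poly[OF cA] as poly_prod_list using that
      by (force simp: prod_list_zero_iff)
  qed
  then have "as = map (\<lambda>a. complex_of_real (Re a)) as" by (auto simp: list_eq_iff_nth_eq)
  then have as': "as = map complex_of_real (map Re as)" by (simp add: comp_def)
  have "map_poly complex_of_real (char_poly A) = char_poly ?A"
    by (simp add: of_real_hom.char_poly_hom[OF A])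
  also have "\<dots> = (\<Prod>a\<leftarrow>map complex_of_real (map Re as). [:- a, 1:])" unfolding as using as' by simp
  also have "\<dots> = map_poly complex_of_real (\<Prod>e\<leftarrow>map Re as. [:- e, 1:])"
    unfolding p.hom_prod_list by (simp add: comp_def map_poly_pCons)
  finally have "char_poly A = (\<Prod>e\<leftarrow>map Re as. [:- e, 1:])"
    using p.injectivity by blast
  then show ?thesis by blast
qed

text \<open>The roots of a product of linear factors, with multiplicity, are the ones written down,
  so sorting merely permutes the factors. Splitting ensures that no eigenvalue is missing and that
  every \<open>nth_eigenvalue A k\<close> with \<open>k\<close> from 1 to \<open>n\<close> is a
  genuine list entry.\<close>

lemma char_poly_eigenvalue_list:
  fixes A :: "real mat"
  assumes A: "A \<in> carrier_mat n n" and sym: "transpose_mat A = A"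
  shows "char_poly A = (\<Prod>e\<leftarrow>eigenvalue_list A. [:- e, 1:])"
    and "length (eigenvalue_list A) = n"
    and "sorted (eigenvalue_list A)"
proof -
  obtain es where es: "char_poly A = (\<Prod>e\<leftarrow>es. [:- e, 1:])"
    using symmetric_char_poly_splits[OF assms] by blast
  have "proots (\<Prod>e\<leftarrow>es. [:- e, 1:]) = mset es"
  proof (induction es)
    case (Cons e es)
    have "(\<Prod>e\<leftarrow>es. [:- e, 1:]) \<noteq> 0" by (auto simp: prod_list_zero_iff)
    then have "proots ([:- e, 1:] * (\<Prod>e\<leftarrow>es. [:- e, 1:])) = {#e#} + mset es"
      using Cons.IH by (subst proots_mult) (simp_all only: proots_linear_factor, auto)
    then show ?case by (simp only: list.map prod_list.Cons mset.simps) simp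
  qed simp
  then have m: "mset (eigenvalue_list A) = mset es"
    unfolding eigenvalue_list_def es by simp
  have "(\<Prod>e\<leftarrow>es. [:- e, 1:]) = prod_mset (image_mset (\<lambda>e. [:- e, 1:]) (mset es))"
    by (simp flip: prod_mset_prod_list)
  also have "\<dots> = (\<Prod>e\<leftarrow>eigenvalue_list A. [:- e, 1:])"
    unfolding m[symmetric] by (simp flip: prod_mset_prod_list)
  finally show *: "char_poly A = (\<Prod>e\<leftarrow>eigenvalue_list A. [:- e, 1:])" unfolding es .
  show "length (eigenvalue_list A) = n"
    using degree_monic_char_poly[OF A] degree_linear_factors[of uminus "eigenvalue_list A"] *
    by simp
  show "sorted (eigenvalue_list A)" unfolding eigenvalue_list_def by simp
qed

section \<open>Orthogonal diagonalization\<close>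

text \<open>Complete \<open>v\<close> to a basis and apply Gram-Schmidt, which keeps the first
  vector; normalizing the results then scales \<open>v\<close> by the inverse of its length.\<close>

lemma orthonormal_completion:
  fixes v :: "real vec"
  assumes v: "v \<in> carrier_vec n" and v0: "v \<noteq> 0\<^sub>v n"
  obtains W c where "W \<in> carrier_mat n n" "transpose_mat W * W = 1\<^sub>m n" "col W 0 = c \<cdot>\<^sub>v v"
proof -
  interpret cof_vec_space n "TYPE(real)" .
  define b where "b = basis_completion v"
  define ws where "ws = gram_schmidt n b"
  note bc = basis_completion[OF v v0, folded b_def]
  have n: "n \<noteq> 0" using v v0 by (metis carrier_vecD eq_vecI index_zero_vec(2) not_less_zero)
  obtain vs where bv: "b = v # vs" using bc(6,7) n by (cases b) auto
  have ws: "set ws \<subseteq> carrier_vec n" "corthogonal ws" "length ws = n"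
    using gram_schmidt_result[OF bc(2,4,5) refl, folded ws_def] bc(6) by auto
  have hd: "hd ws = v" using gram_schmidt_hd[OF v, of vs, folded bv] unfolding ws_def .
  \<comment> \<open>Orthogonality in \<open>corthogonal\<close> involves conjugation, which is the
    identity over the reals.\<close>
  have conj: "conjugate u = u" for u :: "real vec" by (rule eq_vecI) auto
  have orth: "ws ! i \<bullet> ws ! j = 0 \<longleftrightarrow> i \<noteq> j" if "i < n" "j < n" for i j
    using corthogonalD[OF ws(2)] that ws(3) conj by metis
  have car: "ws ! i \<in> carrier_vec n" if "i < n" for i using ws that by auto
  define d where "d w = 1 / sqrt (w \<bullet> w)" for w :: "real vec"
  have pos: "ws ! i \<bullet> ws ! i > 0" if "i < n" for i
    using orth[OF that that] sum_nonneg[of "{0..<dim_vec (ws ! i)}" "\<lambda>k. ws ! i $ k * ws ! i $ k"]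
    by (auto simp: scalar_prod_def order_less_le)
  define W where "W = mat_of_cols n (map (\<lambda>w. d w \<cdot>\<^sub>v w) ws)"
  have W: "W \<in> carrier_mat n n" unfolding W_def using ws(3) by auto
  have colW: "col W i = d (ws ! i) \<cdot>\<^sub>v ws ! i" if "i < n" for i
    unfolding W_def using that ws car by (subst col_mat_of_cols) auto
  have "transpose_mat W * W = 1\<^sub>m n"
  proof (rule eq_matI)
    fix i j assume "i < dim_row (1\<^sub>m n :: real mat)" "j < dim_col (1\<^sub>m n :: real mat)"
    then have i: "i < n" and j: "j < n" by auto
    have "(transpose_mat W * W) $$ (i, j) = col W i \<bullet> col W j" using W i j by auto
    also have "\<dots> = d (ws ! i) * d (ws ! j) * (ws ! i \<bullet> ws ! j)"
      unfolding colW[OF i] colW[OF j] using car[OF i] car[OF j] by simp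
    also have "\<dots> = (1\<^sub>m n :: real mat) $$ (i, j)"
      using orth[OF i j] pos[OF i] i j by (auto simp: d_def)
    finally show "(transpose_mat W * W) $$ (i, j) = (1\<^sub>m n :: real mat) $$ (i, j)" .
  qed (use W in auto)
  moreover have "col W 0 = d v \<cdot>\<^sub>v v"
    using colW[of 0] n hd ws(3) by (metis bot_nat_0.not_eq_extremum hd_conv_nth list.size(3))
  ultimately show thesis using W that by blast
qed

text \<open>Deflation: an orthogonal matrix whose first column is an eigenvector for the head of
  \<open>es\<close> splits off a 1 by 1 block, and the induction hypothesis treats the rest. The
  order of \<open>es\<close> is free and is preserved on the diagonal, so the ascending list can be
  used later.\<close>

theorem symmetric_diagonalization:
  fixes A :: "real mat"
  assumes "A \<in> carrier_mat n n" and "transpose_mat A = A"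
    and "char_poly A = (\<Prod>e\<leftarrow>es. [:- e, 1:])"
  shows "\<exists>P \<in> carrier_mat n n. transpose_mat P * P = 1\<^sub>m n \<and>
           transpose_mat P * A * P = mat_diag n ((!) es)"
  using assms
proof (induction es arbitrary: n A)
  case Nil
  then have "n = 0" using degree_monic_char_poly[of A n] by simp
  then show ?case using Nil by (intro bexI[of _ "1\<^sub>m 0"]) (auto simp: mat_diag_def intro!: eq_matI)
next
  case (Cons e es)
  note A = Cons.prems(1) and sym = Cons.prems(2)
  have cp: "char_poly A = [:- e, 1:] * (\<Prod>e\<leftarrow>es. [:- e, 1:])" using Cons.prems(3) by simp
  have "eigenvalue A e" unfolding eigenvalue_root_char_poly[OF A] cp by simp
  then obtain v where v: "v \<in> carrier_vec n" "v \<noteq> 0\<^sub>v n" "A *\<^sub>v v = e \<cdot>\<^sub>v v"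
    unfolding eigenvalue_def eigenvector_def using A by auto
  obtain m where n: "n = Suc m"
    using v(1,2) by (metis carrier_vecD eq_vecI index_zero_vec(2) not_less_zero not0_implies_Suc)
  obtain W c where W: "W \<in> carrier_mat n n" "transpose_mat W * W = 1\<^sub>m n" "col W 0 = c \<cdot>\<^sub>v v"
    using orthonormal_completion[OF v(1,2)] by blast
  have WT: "transpose_mat W \<in> carrier_mat n n" using W by simp
  have WW: "W * transpose_mat W = 1\<^sub>m n" using mat_mult_left_right_inverse[OF WT W(1,2)] .
  define B where "B = transpose_mat W * A * W"
  have B: "B \<in> carrier_mat n n" unfolding B_def using W A by simp
  have symB: "transpose_mat B = B"
    unfolding B_def using W A WT sym
    by (simp add: transpose_mult[of _ n n _ n] assoc_mult_mat[of _ n n _ n _ n])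
  \<comment> \<open>Column 0 of \<open>W\<close> is an eigenvector for \<open>e\<close> and the
    columns are orthonormal, so column 0 of \<open>B\<close> is \<open>e\<close> times the first
    unit vector. Symmetry of \<open>B\<close> then clears row 0 as well.\<close>
  have B0: "B $$ (i, 0) = (if i = 0 then e else 0)" if i: "i < n" for i
  proof -
    have "col B 0 = transpose_mat W *\<^sub>v (A *\<^sub>v col W 0)"
      unfolding B_def n assoc_mult_mat[OF WT A W(1)]
      using col_mult2[OF WT mult_carrier_mat[OF A W(1)]] col_mult2[OF A W(1)]
      by (metis n zero_less_Suc)
    also have "A *\<^sub>v col W 0 = e \<cdot>\<^sub>v col W 0"
      unfolding W(3) using v A by (simp add: mult_mat_vec smult_smult_assoc mult.commute)
    also have "transpose_mat W *\<^sub>v (e \<cdot>\<^sub>v col W 0) = e \<cdot>\<^sub>v col (transpose_mat W * W) 0"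
      by (subst mult_mat_vec[OF WT]) (use W(1) WT n in \<open>auto simp: col_mult2[of _ n n _ n] intro: carrier_vecI\<close>)
    finally have "col B 0 = e \<cdot>\<^sub>v unit_vec n 0" unfolding W(2) using n by simp
    from arg_cong[OF this, of "\<lambda>u. u $ i"] show ?thesis using i B n by auto
  qed
  have B0': "B $$ (0, i) = (if i = 0 then e else 0)" if "i < n" for i
    using B0[OF that] symB B that n by (metis carrier_matD index_transpose_mat(1) zero_less_Suc)
  define C where "C = mat m m (\<lambda>(i, j). B $$ (Suc i, Suc j))"
  define E where "E = mat 1 1 (\<lambda>_. e)"
  have C: "C \<in> carrier_mat m m" and E: "E \<in> carrier_mat 1 1" unfolding C_def E_def by auto
  have block: "B = four_block_mat E (0\<^sub>m 1 m) (0\<^sub>m m 1) C"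
    by (rule eq_matI) (use B n B0 B0' in \<open>auto simp: C_def E_def\<close>)
  have symC: "transpose_mat C = C"
  proof (rule eq_matI)
    fix i j assume "i < dim_row C" "j < dim_col C"
    then show "transpose_mat C $$ (i, j) = C $$ (i, j)"
      using symB B n by (auto simp: C_def) (metis Suc_less_eq carrier_matD index_transpose_mat(1))
  qed (use C in auto)
  \<comment> \<open>The transpose of \<open>W\<close> is its inverse, so \<open>B\<close> has the
    characteristic polynomial of \<open>A\<close>; cancelling the linear factor of the block
    \<open>E\<close> leaves the remaining factors for \<open>C\<close>.\<close>
  have "similar_mat_wit B A (transpose_mat W) W"
    by (rule similar_mat_witI[of _ _ n]) (use W WW WT A B in \<open>auto simp: B_def\<close>)
  then have "char_poly A = char_poly B" using char_poly_similar unfolding similar_mat_def by metis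
  also have "\<dots> = char_poly E * char_poly C"
    unfolding block by (rule char_poly_four_block_zeros_col[OF E _ C]) simp
  also have "char_poly E = [:- e, 1:]" by (simp add: E_def char_poly_defs det_def sign_def)
  finally have "[:- e, 1:] * char_poly C = [:- e, 1:] * (\<Prod>e\<leftarrow>es. [:- e, 1:])" unfolding cp by simp
  then have "char_poly C = (\<Prod>e\<leftarrow>es. [:- e, 1:])"
    by (metis mult_cancel_left pCons_eq_0_iff zero_neq_one)
  from Cons.IH[OF C symC this] obtain Q where Q: "Q \<in> carrier_mat m m"
    "transpose_mat Q * Q = 1\<^sub>m m" "transpose_mat Q * C * Q = mat_diag m ((!) es)" by blast
  \<comment> \<open>\<open>Q\<close> bordered by a 1 diagonalizes \<open>C\<close> and leaves
    \<open>e\<close> in place as the first diagonal entry.\<close>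
  define R where "R = four_block_mat (1\<^sub>m 1) (0\<^sub>m 1 m) (0\<^sub>m m 1) Q"
  have R: "R \<in> carrier_mat n n" unfolding R_def n using Q four_block_carrier_mat[of "1\<^sub>m 1" 1 1 Q m m] by simp
  have RT: "transpose_mat R = four_block_mat (1\<^sub>m 1) (0\<^sub>m 1 m) (0\<^sub>m m 1) (transpose_mat Q)"
    unfolding R_def using Q by (subst transpose_four_block_mat) auto
  have QT: "transpose_mat Q \<in> carrier_mat m m" using Q by simp
  have RTc: "transpose_mat R \<in> carrier_mat n n" using R by simp
  have RR: "transpose_mat R * R = 1\<^sub>m n"
    unfolding RT unfolding R_def
    by (subst mult_four_block_mat[OF _ _ _ QT _ _ _ Q(1)]) (use Q n QT in \<open>auto intro!: eq_matI\<close>)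
  have RBR: "transpose_mat R * B * R = mat_diag n ((!) (e # es))"
  proof -
    have "transpose_mat R * B = four_block_mat E (0\<^sub>m 1 m) (0\<^sub>m m 1) (transpose_mat Q * C)"
      unfolding RT block
      by (subst mult_four_block_mat[OF _ _ _ QT E _ _ C]) (use Q C E QT in auto)
    also have "\<dots> * R = four_block_mat E (0\<^sub>m 1 m) (0\<^sub>m m 1) (transpose_mat Q * C * Q)"
      unfolding R_def
      by (subst mult_four_block_mat[OF E _ _ mult_carrier_mat[OF QT C] _ _ _ Q(1)]) (use Q C E QT in auto)
    also have "\<dots> = mat_diag n ((!) (e # es))"
      unfolding Q(3) by (rule eq_matI) (auto simp: mat_diag_def n E_def nth_Cons')
    finally show ?thesis .
  qed
  let ?P = "W * R"
  have P: "?P \<in> carrier_mat n n" using W R by simp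
  have PT: "transpose_mat ?P = transpose_mat R * transpose_mat W" using transpose_mult[OF W(1) R] .
  have "transpose_mat ?P * ?P = transpose_mat R * ((transpose_mat W * W) * R)"
    unfolding PT using W(1) R WT RTc by (simp add: assoc_mult_mat[of _ n n _ n _ n])
  then have "transpose_mat ?P * ?P = 1\<^sub>m n" unfolding W(2) using R RR by simp
  moreover have "transpose_mat ?P * A * ?P = transpose_mat R * B * R"
    unfolding PT B_def using W(1) R WT RTc A by (simp add: assoc_mult_mat[of _ n n _ n _ n])
  ultimately show ?case using P RBR by metis
qed

section \<open>Eigenbasis coordinates and Rayleigh bounds\<close>

lemma mat_diag_mult_vec_index:
  fixes x :: "'a :: comm_semiring_1 vec"
  assumes "x \<in> carrier_vec n" "i < n"
  shows "(mat_diag n d *\<^sub>v x) $ i = d i * x $ i"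
  using assms by (simp add: mat_diag_def scalar_prod_def if_distrib[of "\<lambda>z. z * _"] cong: if_cong)

text \<open>\<open>P\<close> sends a vector to its coordinates in an orthonormal eigenbasis, ordered
  by ascending eigenvalue. It is the transpose of the diagonalizing matrix \<open>U\<close>, hence
  orthogonal.\<close>

lemma spectral_decomposition:
  fixes A :: "real mat"
  assumes A: "A \<in> carrier_mat n n" and sym: "transpose_mat A = A"
  obtains P where "P \<in> carrier_mat n n"
    and "\<And>x y. x \<in> carrier_vec n \<Longrightarrow> y \<in> carrier_vec n \<Longrightarrow>
           (P *\<^sub>v x) \<bullet> (P *\<^sub>v y) = x \<bullet> y"
    and "\<And>x i. x \<in> carrier_vec n \<Longrightarrow> i < n \<Longrightarrow>
           (P *\<^sub>v (A *\<^sub>v x)) $ i = eigenvalue_list A ! i * (P *\<^sub>v x) $ i"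
proof -
  obtain U where U: "U \<in> carrier_mat n n" "transpose_mat U * U = 1\<^sub>m n"
    and D: "transpose_mat U * A * U = mat_diag n ((!) (eigenvalue_list A))"
    using symmetric_diagonalization[OF A sym char_poly_eigenvalue_list(1)[OF A sym]] by blast
  let ?P = "transpose_mat U"
  have P: "?P \<in> carrier_mat n n" using U by simp
  have UP: "U * ?P = 1\<^sub>m n" using mat_mult_left_right_inverse[OF P U] .
  show thesis
  proof (rule that[OF P])
    fix x y :: "real vec" assume x: "x \<in> carrier_vec n" and y: "y \<in> carrier_vec n"
    have "(?P *\<^sub>v x) \<bullet> (?P *\<^sub>v y) = x \<bullet> (U *\<^sub>v (?P *\<^sub>v y))"
      using transpose_vec_mult_scalar[OF U(1) mult_mat_vec_carrier[OF P y] x] U(1) P x y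
      by (metis comm_scalar_prod mult_mat_vec_carrier)
    also have "U *\<^sub>v (?P *\<^sub>v y) = y"
      using assoc_mult_mat_vec[OF U(1) P y] UP y by simp
    finally show "(?P *\<^sub>v x) \<bullet> (?P *\<^sub>v y) = x \<bullet> y" .
  next
    fix x :: "real vec" and i assume x: "x \<in> carrier_vec n" and i: "i < n"
    have Px: "?P *\<^sub>v x \<in> carrier_vec n" using P x by simp
    have "?P * A = ?P * A * (U * ?P)" using UP A P by simp
    also have "\<dots> = mat_diag n ((!) (eigenvalue_list A)) * ?P"
      unfolding D[symmetric] using A P U(1) by (simp add: assoc_mult_mat[of _ n n _ n _ n])
    finally have "?P *\<^sub>v (A *\<^sub>v x) = mat_diag n ((!) (eigenvalue_list A)) *\<^sub>v (?P *\<^sub>v x)"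
      using A P x by (metis assoc_mult_mat_vec mat_diag_dim)
    also have "\<dots> $ i = eigenvalue_list A ! i * (?P *\<^sub>v x) $ i" by (rule mat_diag_mult_vec_index[OF Px i])
    finally show "(?P *\<^sub>v (A *\<^sub>v x)) $ i = eigenvalue_list A ! i * (?P *\<^sub>v x) $ i" .
  qed
qed

text \<open>In eigenbasis coordinates the form is a sum of squares weighted by the eigenvalues; each
  weight is at most the last list entry, and the squares add up to
  \<open>x \<bullet> x\<close>.\<close>

lemma rayleigh_le_largest_eigenvalue:
  fixes A :: "real mat"
  assumes A: "A \<in> carrier_mat n n" and sym: "transpose_mat A = A" and x: "x \<in> carrier_vec n"
  shows "x \<bullet> (A *\<^sub>v x) \<le> nth_eigenvalue A n * (x \<bullet> x)"
proof -
  obtain P where P: "P \<in> carrier_mat n n"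
    "\<And>x y. x \<in> carrier_vec n \<Longrightarrow> y \<in> carrier_vec n \<Longrightarrow> (P *\<^sub>v x) \<bullet> (P *\<^sub>v y) = x \<bullet> y"
    "\<And>x i. x \<in> carrier_vec n \<Longrightarrow> i < n \<Longrightarrow>
           (P *\<^sub>v (A *\<^sub>v x)) $ i = eigenvalue_list A ! i * (P *\<^sub>v x) $ i"
    using spectral_decomposition[OF A sym] by blast
  define y where "y = P *\<^sub>v x"
  have y: "dim_vec y = n" unfolding y_def using P(1) by simp
  note l = char_poly_eigenvalue_list(2,3)[OF A sym]
  have "x \<bullet> (A *\<^sub>v x) = y \<bullet> (P *\<^sub>v (A *\<^sub>v x))"
    unfolding y_def using P(2) x A by simp
  also have "\<dots> = (\<Sum>i = 0..<n. eigenvalue_list A ! i * (y $ i)\<^sup>2)"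
    unfolding scalar_prod_def using P(1) P(3)[OF x, folded y_def]
    by (intro sum.cong) (auto simp: power2_eq_square)
  also have "\<dots> \<le> (\<Sum>i = 0..<n. nth_eigenvalue A n * (y $ i)\<^sup>2)"
    unfolding nth_eigenvalue_def using l
    by (intro sum_mono mult_right_mono) (auto intro!: sorted_nth_mono)
  also have "\<dots> = nth_eigenvalue A n * (y \<bullet> y)"
    using y by (simp add: scalar_prod_def sum_distrib_left power2_eq_square)
  finally show ?thesis using P(2)[OF x x] unfolding y_def by simp
qed

text \<open>If \<open>\<lambda>\<^sub>2 > 0\<close>, the kernel vector \<open>u\<close> spans the first eigenspace, so
  \<open>x\<close> has no component there.\<close>

lemma second_eigenvalue_le_rayleigh:
  fixes A :: "real mat"
  assumes A: "A \<in> carrier_mat n n" and sym: "transpose_mat A = A" and n: "2 \<le> n"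
    and psd: "\<And>x. x \<in> carrier_vec n \<Longrightarrow> 0 \<le> x \<bullet> (A *\<^sub>v x)"
    and u: "u \<in> carrier_vec n" "u \<noteq> 0\<^sub>v n" "A *\<^sub>v u = 0\<^sub>v n"
    and x: "x \<in> carrier_vec n" "u \<bullet> x = 0"
  shows "nth_eigenvalue A 2 * (x \<bullet> x) \<le> x \<bullet> (A *\<^sub>v x)"
proof (cases "nth_eigenvalue A 2 \<le> 0")
  \<comment> \<open>A nonpositive second eigenvalue makes the left side nonpositive, and the form is
    nonnegative.\<close>
  case True
  have "0 \<le> x \<bullet> x" by (auto simp: scalar_prod_def intro!: sum_nonneg)
  then show ?thesis using True psd[OF x(1)] by (meson mult_nonpos_nonneg order_trans)
next
  case False
  obtain P where P: "P \<in> carrier_mat n n"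
    "\<And>x y. x \<in> carrier_vec n \<Longrightarrow> y \<in> carrier_vec n \<Longrightarrow> (P *\<^sub>v x) \<bullet> (P *\<^sub>v y) = x \<bullet> y"
    "\<And>x i. x \<in> carrier_vec n \<Longrightarrow> i < n \<Longrightarrow>
           (P *\<^sub>v (A *\<^sub>v x)) $ i = eigenvalue_list A ! i * (P *\<^sub>v x) $ i"
    using spectral_decomposition[OF A sym] by blast
  define y where "y = P *\<^sub>v x"
  define w where "w = P *\<^sub>v u"
  have y: "dim_vec y = n" and w: "dim_vec w = n" unfolding y_def w_def using P(1) by auto
  note l = char_poly_eigenvalue_list(2,3)[OF A sym]
  \<comment> \<open>\<open>nth_eigenvalue A 2\<close> is the list entry with index 1, so all indices
    but 0 are covered.\<close>
  have ge: "nth_eigenvalue A 2 \<le> eigenvalue_list A ! i" if "i < n" "0 < i" for i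
    unfolding nth_eigenvalue_def using l that by (auto intro!: sorted_nth_mono)
  have "P *\<^sub>v 0\<^sub>v n = 0\<^sub>v n" using P(1) by (auto intro!: eq_vecI)
  \<comment> \<open>Since \<open>u\<close> lies in the kernel, each eigenvalue times the matching
    coordinate of \<open>w\<close> is 0, and from index 1 on the eigenvalues are positive.\<close>
  then have w0: "w $ i = 0" if "i < n" "0 < i" for i
    using P(3)[OF u(1) that(1)] ge[OF that] False that unfolding u(3) w_def by auto
  have split: "{0..<n} = insert 0 {1..<n}" using n by auto
  have first: "a \<bullet> b = a $ 0 * b $ 0" if "dim_vec b = n" "\<And>i. i < n \<Longrightarrow> 0 < i \<Longrightarrow> a $ i = 0" for a b :: "real vec"
    unfolding scalar_prod_def that(1) split using that(2) by simp
  have "w \<bullet> w = u \<bullet> u" "w \<bullet> y = 0" unfolding w_def y_def using P(2) u x by auto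
  moreover have "u \<bullet> u \<noteq> 0"
  proof
    assume "u \<bullet> u = 0"
    then have "\<forall>i<n. u $ i = 0" using u(1) by (simp add: scalar_prod_def sum_nonneg_eq_0_iff)
    then show False using u(1,2) by (metis carrier_vecD eq_vecI index_zero_vec)
  qed
  \<comment> \<open>As \<open>w\<close> lives in coordinate 0 only, \<open>w $ 0 * y $ 0\<close> is
    0 while the square of \<open>w $ 0\<close> is \<open>u \<bullet> u\<close>, which is
    nonzero.\<close>
  ultimately have y0: "y $ 0 = 0" using first[OF w w0] first[OF y w0] by auto
  have "nth_eigenvalue A 2 * (x \<bullet> x) = nth_eigenvalue A 2 * (y \<bullet> y)" unfolding y_def using P(2) x by simp
  also have "\<dots> = (\<Sum>i = 0..<n. nth_eigenvalue A 2 * (y $ i)\<^sup>2)"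
    using y by (simp add: scalar_prod_def sum_distrib_left power2_eq_square)
  also have "\<dots> \<le> (\<Sum>i = 0..<n. eigenvalue_list A ! i * (y $ i)\<^sup>2)"
  proof (rule sum_mono)
    fix i assume "i \<in> {0..<n}"
    then show "nth_eigenvalue A 2 * (y $ i)\<^sup>2 \<le> eigenvalue_list A ! i * (y $ i)\<^sup>2"
      using y0 ge[of i] by (cases "i = 0") (auto intro: mult_right_mono)
  qed
  also have "\<dots> = y \<bullet> (P *\<^sub>v (A *\<^sub>v x))"
    unfolding scalar_prod_def using P(1) P(3)[OF x(1), folded y_def]
    by (intro sum.cong) (auto simp: power2_eq_square)
  also have "\<dots> = x \<bullet> (A *\<^sub>v x)" unfolding y_def using P(2) x A by simp
  finally show ?thesis .
qed

text \<open>This serves the edgeless hypergraph. A list entry is a root, hence has an eigenvector,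
  and a nonzero coordinate of that vector forces the eigenvalue to vanish.\<close>

lemma nth_eigenvalue_zero_mat:
  assumes "0 < k" "k \<le> n"
  shows "nth_eigenvalue (0\<^sub>m n n) k = 0"
proof -
  let ?Z = "0\<^sub>m n n :: real mat"
  have Z: "?Z \<in> carrier_mat n n" "transpose_mat ?Z = ?Z" by auto
  let ?e = "nth_eigenvalue ?Z k"
  have "?e \<in> set (eigenvalue_list ?Z)"
    unfolding nth_eigenvalue_def using char_poly_eigenvalue_list(2)[OF Z] assms by auto
  then have "eigenvalue ?Z ?e"
    unfolding eigenvalue_root_char_poly[OF Z(1)] char_poly_eigenvalue_list(1)[OF Z] poly_prod_list
    by (force simp: prod_list_zero_iff)
  then obtain v where v: "v \<in> carrier_vec n" "v \<noteq> 0\<^sub>v n" "?Z *\<^sub>v v = ?e \<cdot>\<^sub>v v"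
    unfolding eigenvalue_def eigenvector_def by auto
  obtain i where i: "i < n" "v $ i \<noteq> 0"
    using v(1,2) by (metis carrier_vecD eq_vecI index_zero_vec)
  from arg_cong[OF v(3), of "\<lambda>u. u $ i"] show ?thesis using i v(1) by simp
qed

section \<open>The Laplacian and its quadratic form\<close>

lemma hypergraph_finite_edges: "hypergraph V E \<Longrightarrow> finite E"
  unfolding hypergraph_def by (meson PowI finite_Pow_iff finite_subset subsetI)

lemma adj_commute: "adj E i j = adj E j i"
  by (auto simp: adj_def intro!: arg_cong[of _ _ card])

lemma laplacian_carrier: "laplacian n E \<in> carrier_mat n n"
  by (auto simp: laplacian_def adjacency_matrix_def)

lemma laplacian_symmetric: "transpose_mat (laplacian n E) = laplacian n E"
  by (rule eq_matI) (auto simp: laplacian_def adjacency_matrix_def mat_diag_def adj_commute)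

lemma laplacian_empty: "laplacian n {} = 0\<^sub>m n n"
  by (rule eq_matI)
    (auto simp: laplacian_def adjacency_matrix_def mat_diag_def laplacian_degree_def adj_def)

text \<open>Absorbs the index shift: functions on the vertices \<open>1..n\<close> become vectors
  indexed from 0, so later sums run over vertices.\<close>

definition vertex_vec :: "nat \<Rightarrow> (nat \<Rightarrow> real) \<Rightarrow> real vec" where
  "vertex_vec n f = vec n (\<lambda>i. f (Suc i))"

lemma vertex_vec_carrier [simp]: "vertex_vec n f \<in> carrier_vec n"
  by (simp add: vertex_vec_def)

lemma vertex_vec_scalar_prod: "vertex_vec n f \<bullet> vertex_vec n g = (\<Sum>i\<in>{1..n}. f i * g i)"
  by (simp add: vertex_vec_def scalar_prod_def sum.atLeast1_atMost_eq lessThan_atLeast0)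

text \<open>The Laplacian degree is the row sum of the adjacency matrix, so the diagonal term merges
  with the others into differences.\<close>

lemma laplacian_mult_vertex_vec:
  "laplacian n E *\<^sub>v vertex_vec n f =
     vertex_vec n (\<lambda>i. \<Sum>j\<in>{1..n}. real (adj E i j) * (f i - f j))"
proof (rule eq_vecI)
  fix i assume "i < dim_vec (vertex_vec n (\<lambda>i. \<Sum>j\<in>{1..n}. real (adj E i j) * (f i - f j)))"
  then have i: "i < n" by (simp add: vertex_vec_def)
  have "(laplacian n E *\<^sub>v vertex_vec n f) $ i =
      (\<Sum>j = 0..<n. ((if j = i then real (laplacian_degree {1..n} E (Suc i)) else 0)
         - real (adj E (Suc i) (Suc j))) * f (Suc j))"
    using i by (auto simp: laplacian_def adjacency_matrix_def mat_diag_def vertex_vec_def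
        scalar_prod_def intro!: sum.cong)
  also have "\<dots> = (\<Sum>j = 0..<n. if j = i then real (laplacian_degree {1..n} E (Suc i)) * f (Suc j) else 0)
      - (\<Sum>j = 0..<n. real (adj E (Suc i) (Suc j)) * f (Suc j))"
    unfolding sum_subtractf[symmetric] by (intro sum.cong) (auto simp: algebra_simps)
  also have "\<dots> = real (laplacian_degree {1..n} E (Suc i)) * f (Suc i)
      - (\<Sum>j\<in>{1..n}. real (adj E (Suc i) j) * f j)"
    using i by (simp add: sum.atLeast1_atMost_eq lessThan_atLeast0)
  also have "\<dots> = (\<Sum>j\<in>{1..n}. real (adj E (Suc i) j) * (f (Suc i) - f j))"
    unfolding laplacian_degree_def by (simp add: sum_subtractf sum_distrib_right right_diff_distrib)
  finally show "(laplacian n E *\<^sub>v vertex_vec n f) $ i =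
      vertex_vec n (\<lambda>i. \<Sum>j\<in>{1..n}. real (adj E i j) * (f i - f j)) $ i"
    using i by (simp add: vertex_vec_def)
qed (simp add: vertex_vec_def laplacian_def adjacency_matrix_def)

text \<open>Symmetrizing in \<open>i\<close> and \<open>j\<close> produces squares; writing
  \<open>adj\<close> as a count of edges and exchanging sums groups them by edge. The half arises
  because ordered pairs are summed.\<close>

lemma laplacian_quadratic_form:
  assumes "hypergraph {1..n} E"
  shows "vertex_vec n f \<bullet> (laplacian n E *\<^sub>v vertex_vec n f) =
           (\<Sum>e\<in>E. \<Sum>i\<in>e. \<Sum>j\<in>e. (f i - f j)\<^sup>2) / 2"
proof -
  let ?V = "{1..n}"
  have sub: "e \<subseteq> ?V" if "e \<in> E" for e using assms that by (auto simp: hypergraph_def)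
  have fin: "finite E" using hypergraph_finite_edges[OF assms] .
  define Q where "Q = (\<Sum>i\<in>?V. \<Sum>j\<in>?V. real (adj E i j) * (f i * (f i - f j)))"
  have form: "vertex_vec n f \<bullet> (laplacian n E *\<^sub>v vertex_vec n f) = Q"
    unfolding laplacian_mult_vertex_vec vertex_vec_scalar_prod Q_def
    by (simp add: sum_distrib_left mult_ac)
  have Q': "Q = (\<Sum>i\<in>?V. \<Sum>j\<in>?V. real (adj E i j) * (f j * (f j - f i)))"
    unfolding Q_def by (subst sum.swap) (simp add: adj_commute)
  have "Q + Q = (\<Sum>i\<in>?V. \<Sum>j\<in>?V. real (adj E i j) * (f i - f j)\<^sup>2)"
    by (subst (2) Q', unfold Q_def sum.distrib[symmetric])
      (simp add: power2_eq_square algebra_simps)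
  also have "\<dots> = (\<Sum>i\<in>?V. \<Sum>j\<in>?V. \<Sum>e\<in>E. if i \<in> e \<and> j \<in> e then (f i - f j)\<^sup>2 else 0)"
  proof (intro sum.cong refl)
    fix i j
    \<comment> \<open>For \<open>i = j\<close> the left side is 0 by the definition of
      \<open>adj\<close>, the right side because the difference is 0.\<close>
    show "real (adj E i j) * (f i - f j)\<^sup>2 = (\<Sum>e\<in>E. if i \<in> e \<and> j \<in> e then (f i - f j)\<^sup>2 else 0)"
      using fin by (cases "i = j") (auto simp: adj_def sum.If_cases Int_def)
  qed
  also have "\<dots> = (\<Sum>i\<in>?V. \<Sum>e\<in>E. \<Sum>j\<in>?V. if i \<in> e \<and> j \<in> e then (f i - f j)\<^sup>2 else 0)"
    by (intro sum.cong refl sum.swap)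
  also have "\<dots> = (\<Sum>e\<in>E. \<Sum>i\<in>?V. \<Sum>j\<in>?V. if i \<in> e \<and> j \<in> e then (f i - f j)\<^sup>2 else 0)"
    by (rule sum.swap)
  also have "\<dots> = (\<Sum>e\<in>E. \<Sum>i\<in>e. \<Sum>j\<in>e. (f i - f j)\<^sup>2)"
  proof (rule sum.cong[OF refl])
    fix e assume e: "e \<in> E"
    have "(\<Sum>i\<in>?V. \<Sum>j\<in>?V. if i \<in> e \<and> j \<in> e then (f i - f j)\<^sup>2 else 0) =
        (\<Sum>i\<in>?V. if i \<in> e then \<Sum>j\<in>?V. if j \<in> e then (f i - f j)\<^sup>2 else 0 else 0)"
      by (intro sum.cong) auto
    then show "(\<Sum>i\<in>?V. \<Sum>j\<in>?V. if i \<in> e \<and> j \<in> e then (f i - f j)\<^sup>2 else 0) =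
        (\<Sum>i\<in>e. \<Sum>j\<in>e. (f i - f j)\<^sup>2)"
      using sub[OF e] by (simp add: sum.inter_restrict[symmetric] Int_absorb1)
  qed
  finally show ?thesis unfolding form by simp
qed

section \<open>Counting pairs of an edge that are separated by \<open>S\<close>\<close>

text \<open>Only pairs separated by \<open>S\<close> contribute, each with
  \<open>(a - b)\<^sup>2\<close>; the factor 2 counts both orders.\<close>

lemma sum_square_diff_two_valued:
  fixes a b :: real
  assumes "finite e"
  shows "(\<Sum>i\<in>e. \<Sum>j\<in>e. ((if i \<in> S then a else b) - (if j \<in> S then a else b))\<^sup>2) =
           2 * (a - b)\<^sup>2 * (card (e \<inter> S) * card (e - S))"
proof -
  have split: "(\<Sum>i\<in>e. if i \<in> S then x else y) = card (e \<inter> S) * x + card (e - S) * y" for x y :: real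
    using assms by (simp add: sum.If_cases Int_def Diff_eq)
  have "(\<Sum>j\<in>e. ((if i \<in> S then a else b) - (if j \<in> S then a else b))\<^sup>2) =
      (if i \<in> S then card (e - S) * (a - b)\<^sup>2 else card (e \<inter> S) * (a - b)\<^sup>2)" for i
  proof -
    have "(\<Sum>j\<in>e. ((if i \<in> S then a else b) - (if j \<in> S then a else b))\<^sup>2) =
      (\<Sum>j\<in>e. if j \<in> S then (if i \<in> S then 0 else (a - b)\<^sup>2) else (if i \<in> S then (a - b)\<^sup>2 else 0))"
      by (intro sum.cong) (auto simp: power2_commute)
    then show ?thesis unfolding split by simp
  qed
  then show ?thesis by (simp add: split)
qed

text \<open>With parts of sizes p and q, both at least 1, this is (p - 1)(q - 1) \<ge> 0.\<close>

lemma card_sub_one_le_cut_product: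
  assumes "finite e" "e \<inter> S \<noteq> {}" "e - S \<noteq> {}"
  shows "real (card e) - 1 \<le> real (card (e \<inter> S)) * real (card (e - S))"
proof -
  have "card e = card (e \<inter> S) + card (e - S)"
    using assms(1) by (metis card_Int_Diff)
  moreover have "card (e \<inter> S) \<ge> 1" "card (e - S) \<ge> 1"
    using assms by (simp_all add: Suc_le_eq card_gt_0_iff)
  then have "0 \<le> (real (card (e \<inter> S)) - 1) * (real (card (e - S)) - 1)" by simp
  ultimately show ?thesis by (simp add: algebra_simps)
qed

text \<open>With parts of sizes p and q, this is the nonnegativity of the square of p - q.\<close>

lemma cut_product_le_square:
  assumes "finite e"
  shows "4 * (real (card (e \<inter> S)) * real (card (e - S))) \<le> (real (card e))\<^sup>2"
proof -
  have "real (card e) = real (card (e \<inter> S)) + real (card (e - S))"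
    using assms by (metis card_Int_Diff of_nat_add)
  moreover have "0 \<le> (real (card (e \<inter> S)) - real (card (e - S)))\<^sup>2" by simp
  ultimately show ?thesis by (simp add: power2_eq_square algebra_simps)
qed

lemma cut_sum_bounds:
  fixes V S :: "'v set"
  assumes H: "hypergraph V E" and ne: "E \<noteq> {}"
  defines "T \<equiv> (\<Sum>e\<in>E. real (card (e \<inter> S)) * real (card (e - S)))"
  shows "(real (min_edge_size E) - 1) * real (card (edge_boundary V E S)) \<le> T"
    and "4 * T \<le> (real (max_edge_size E))\<^sup>2 * real (card (edge_boundary V E S))"
proof -
  have sub: "finite e" "e \<subseteq> V" if "e \<in> E" for e
    using H that by (auto simp: hypergraph_def intro: finite_subset)
  have fin: "finite E" using hypergraph_finite_edges[OF H] .
  let ?D = "edge_boundary V E S"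
  have D: "e \<in> E" "e \<inter> S \<noteq> {}" "e - S \<noteq> {}" if "e \<in> ?D" for e
    using that by (auto simp: edge_boundary_def)
  \<comment> \<open>An edge lies inside \<open>V\<close>, so off the boundary it misses
    \<open>S\<close> or is contained in \<open>S\<close>; one factor is then 0.\<close>
  have T: "T = (\<Sum>e\<in>?D. real (card (e \<inter> S)) * real (card (e - S)))"
    unfolding T_def
  proof (rule sum.mono_neutral_right[OF fin])
    show "\<forall>e\<in>E - ?D. real (card (e \<inter> S)) * real (card (e - S)) = 0"
    proof
      fix e assume e: "e \<in> E - ?D"
      then have "e \<inter> S = {} \<or> e - S = {}" using sub by (auto simp: edge_boundary_def)
      then show "real (card (e \<inter> S)) * real (card (e - S)) = 0"
        by (metis card.empty mult_zero_left mult_zero_right of_nat_0)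
    qed
  qed (use D in auto)
  have "(\<Sum>e\<in>?D. real (min_edge_size E) - 1) \<le> T"
    unfolding T
  proof (rule sum_mono)
    fix e assume e: "e \<in> ?D"
    have "min_edge_size E \<le> card e" unfolding min_edge_size_def using fin D[OF e] by simp
    then show "real (min_edge_size E) - 1 \<le> real (card (e \<inter> S)) * real (card (e - S))"
      using card_sub_one_le_cut_product[OF sub(1) D(2,3)] D(1) e by fastforce
  qed
  then show "(real (min_edge_size E) - 1) * real (card ?D) \<le> T" by (simp add: mult.commute)
  have "4 * T \<le> (\<Sum>e\<in>?D. (real (max_edge_size E))\<^sup>2)"
    unfolding T sum_distrib_left
  proof (rule sum_mono)
    fix e assume e: "e \<in> ?D"
    have "card e \<le> max_edge_size E" unfolding max_edge_size_def using fin D[OF e] by simp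
    then have "(real (card e))\<^sup>2 \<le> (real (max_edge_size E))\<^sup>2" by (intro power_mono) auto
    then show "4 * (real (card (e \<inter> S)) * real (card (e - S))) \<le> (real (max_edge_size E))\<^sup>2"
      using cut_product_le_square[OF sub(1)[OF D(1)[OF e]], of S] by linarith
  qed
  then show "4 * T \<le> (real (max_edge_size E))\<^sup>2 * real (card ?D)" by (simp add: mult.commute)
qed

section \<open>Bounds on the edge density\<close>

theorem theorem3p2:
  fixes n :: nat and E :: "nat set set" and S :: "nat set"
  assumes "hypergraph {1..n} E"
    and "\<forall>e\<in>E. 2 \<le> card e"
    and "S \<noteq> {}" and "S \<subset> {1..n}"
  shows "4 * nth_eigenvalue (laplacian n E) 2 / (real n * (real (max_edge_size E))\<^sup>2)
           \<le> edge_density {1..n} E S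
       \<and> edge_density {1..n} E S
           \<le> nth_eigenvalue (laplacian n E) n / (real n * (real (min_edge_size E) - 1))"
proof -
  have finS: "finite S" using assms(4) by (meson finite_atLeastAtMost finite_subset psubsetE)
  define s where "s = card S"
  \<comment> \<open>These bounds also give \<open>2 \<le> n\<close>, so a second eigenvalue
    exists.\<close>
  have s: "0 < s" "s < n"
    unfolding s_def using assms(3,4) finS psubset_card_mono[OF _ assms(4)] by (auto simp: card_gt_0_iff)
  show ?thesis
  proof (cases "E = {}")
    case True
    \<comment> \<open>The edge sizes are unspecified here, so both eigenvalues have to be exactly \<open>0\<close>.\<close>
    then show ?thesis using s
      by (simp add: laplacian_empty nth_eigenvalue_zero_mat edge_density_def edge_boundary_def)
  next
    case False
    let ?L = "laplacian n E"
    let ?one = "vertex_vec n (\<lambda>_. 1)"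
    let ?D = "edge_boundary {1..n} E S"
    \<comment> \<open>The values are weighted to sum to 0 over all vertices, and they differ by
      \<open>n\<close>, the source of the factor \<open>n\<^sup>2\<close> in
      \<open>xLx\<close>.\<close>
    define f where "f i = (if i \<in> S then real n - real s else - real s)" for i
    define x where "x = vertex_vec n f"
    define T where "T = (\<Sum>e\<in>E. real (card (e \<inter> S)) * real (card (e - S)))"
    note L = laplacian_carrier[of n E] laplacian_symmetric[of n E]
    have two_valued: "(\<Sum>i\<in>{1..n}. if i \<in> S then a else b) = s * a + (real n - s) * b" for a b :: real
    proof -
      have "{1..n} \<inter> S = S" using assms(4) by auto
      moreover have "card ({1..n} - S) = n - s"
        unfolding s_def using assms(4) finS by (subst card_Diff_subset) auto
      ultimately show ?thesis using s by (simp add: sum.If_cases s_def of_nat_diff Diff_eq)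
    qed
    have xx: "x \<bullet> x = n * (s * (real n - s))"
    proof -
      have "x \<bullet> x = (\<Sum>i\<in>{1..n}. if i \<in> S then (real n - s)\<^sup>2 else (real s)\<^sup>2)"
        unfolding x_def vertex_vec_scalar_prod by (intro sum.cong) (auto simp: f_def power2_eq_square)
      then show ?thesis unfolding two_valued by (simp add: power2_eq_square algebra_simps)
    qed
    have onex: "?one \<bullet> x = 0"
      unfolding x_def vertex_vec_scalar_prod f_def mult_1 two_valued by (simp add: algebra_simps)
    have xLx: "x \<bullet> (?L *\<^sub>v x) = n\<^sup>2 * T"
    proof -
      have "finite e" if "e \<in> E" for e
        using assms(1) that by (auto simp: hypergraph_def intro: finite_subset)
      then have "(\<Sum>e\<in>E. \<Sum>i\<in>e. \<Sum>j\<in>e. (f i - f j)\<^sup>2) =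
          (\<Sum>e\<in>E. 2 * (real n)\<^sup>2 * (real (card (e \<inter> S)) * real (card (e - S))))"
        unfolding f_def by (intro sum.cong refl) (simp add: sum_square_diff_two_valued)
      then show ?thesis
        unfolding x_def laplacian_quadratic_form[OF assms(1)] T_def
        by (simp flip: sum_distrib_left)
    qed
    have psd: "0 \<le> v \<bullet> (?L *\<^sub>v v)" if "v \<in> carrier_vec n" for v
    proof -
      \<comment> \<open>Every vector comes from a function on the vertices, so its form is a sum of
        squares.\<close>
      have "v = vertex_vec n (\<lambda>i. v $ (i - 1))" using that by (auto simp: vertex_vec_def)
      then show ?thesis
        by (metis (no_types, lifting) laplacian_quadratic_form[OF assms(1)] divide_nonneg_nonneg
            sum_nonneg zero_le_numeral zero_le_power2)
    qed
    have "?L *\<^sub>v ?one = 0\<^sub>v n" unfolding laplacian_mult_vertex_vec by (auto simp: vertex_vec_def)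
    moreover have "?one \<noteq> 0\<^sub>v n"
    proof
      assume "?one = 0\<^sub>v n"
      then have "?one $ 0 = 0\<^sub>v n $ 0" by simp
      then show False using s by (simp add: vertex_vec_def)
    qed
    ultimately have "nth_eigenvalue ?L 2 * (x \<bullet> x) \<le> x \<bullet> (?L *\<^sub>v x)"
      using s onex by (intro second_eigenvalue_le_rayleigh[OF L _ psd, of ?one]) (auto simp: x_def)
    \<comment> \<open>Both sides carry a factor \<open>n\<close>, one from
      \<open>x \<bullet> x\<close> and one of the two in the quadratic form; it is
      cancelled.\<close>
    then have "n * (nth_eigenvalue ?L 2 * (s * (real n - s))) \<le> n * (n * T)"
      unfolding xx xLx by (simp add: power2_eq_square mult_ac)
    then have lower: "nth_eigenvalue ?L 2 * (s * (real n - s)) \<le> n * T"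
      using s by (simp only: mult_le_cancel_left_pos of_nat_0_less_iff)
    have "n\<^sup>2 * T \<le> nth_eigenvalue ?L n * (x \<bullet> x)"
      using rayleigh_le_largest_eigenvalue[OF L, of x] unfolding xLx by (simp add: x_def)
    then have "n * (n * T) \<le> n * (nth_eigenvalue ?L n * (s * (real n - s)))"
      unfolding xx by (simp add: power2_eq_square mult_ac)
    then have upper: "n * T \<le> nth_eigenvalue ?L n * (s * (real n - s))"
      using s by (simp only: mult_le_cancel_left_pos of_nat_0_less_iff)
    note cut = cut_sum_bounds[OF assms(1) False, of S, folded T_def]
    have finE: "finite E" using hypergraph_finite_edges[OF assms(1)] .
    \<comment> \<open>With edges present, both extreme sizes are attained, hence at least 2, and
      both denominators in the claim are positive.\<close>
    have "min_edge_size E \<in> card ` E" "max_edge_size E \<in> card ` E"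
      unfolding min_edge_size_def max_edge_size_def using finE False by (auto intro!: Min_in Max_in)
    then have k: "2 \<le> min_edge_size E" "2 \<le> max_edge_size E" using assms(2) by auto
    have d: "0 < s * (real n - s)" "0 < real n" using s by auto
    have \<rho>: "edge_density {1..n} E S = real (card ?D) / (s * (real n - s))"
      by (simp add: edge_density_def s_def)
    \<comment> \<open>The spectral bound on \<open>T\<close> followed by its bound through the
      boundary gives the lower estimate after division; the upper one chains the same two kinds of
      bounds in the opposite direction.\<close>
    have "4 * (nth_eigenvalue ?L 2 * (s * (real n - s))) \<le> n * (4 * T)" using lower by simp
    also have "\<dots> \<le> n * ((real (max_edge_size E))\<^sup>2 * real (card ?D))"
      using cut(2) by (intro mult_left_mono) auto
    finally have "4 * nth_eigenvalue ?L 2 / (real n * (real (max_edge_size E))\<^sup>2)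
        \<le> real (card ?D) / (s * (real n - s))"
      using d k by (simp add: pos_divide_le_eq pos_le_divide_eq mult_ac)
    moreover have "n * ((real (min_edge_size E) - 1) * real (card ?D)) \<le> n * T"
      using cut(1) by (intro mult_left_mono) auto
    note order_trans[OF this upper]
    then have "real (card ?D) / (s * (real n - s))
        \<le> nth_eigenvalue ?L n / (real n * (real (min_edge_size E) - 1))"
      using d k by (simp add: pos_divide_le_eq pos_le_divide_eq mult_ac)
    ultimately show ?thesis unfolding \<rho> by simp
  qed
qed

end
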